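(* Let $A\in\mathbf{R}^{m\times n}$ have unit $\ell_2$-norm columns, let $x^*\in\mathbf{R}^n$ with $\|x^*\|_0=k^*\ge1$, let $\epsilon\in\mathbf{R}^m$, and $b=Ax^*+\epsilon$. Let $\{x^{(t)}\}_{t\ge0}$ be a sequence generated by the AIT algorithm with sparsity level $k$, step size $s$, initial point $x^{(0)}\in\mathbf{R}^n$, and a defining function with boundedness parameters $0\le c_2\le c_1\le1$. Put $L=(3-c_2)k^*$. Assume that the coherence $\mu$ of $A$ satisfies $0<\mu<\frac{1}{(3-c_2)k^*}$, and that (i) $k=k^*$; (ii) $1-\frac1L<s<\min\{\frac{1}{L\mu},\,1+\frac1L\}$. Then, with $\gamma_s=\max\{|1-s|,s\mu\}$ and $\rho_s=\gamma_sL$, one has $\rho_s<1$ and for all $t$ $$\|x^{(t)}-x^*\|_1\le(\rho_s)^t\|x^*-x^{(0)}\|_1+\frac{sL}{1-\rho_s}\|A^T\epsilon\|_\infty.$$ In particular, when $\epsilon=0$, $\|x^{(t)}-x^*\|_1\le(\rho_s)^t\|x^*-x^{(0)}\|_1$.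
   Context: $\|x\|_0$ is the number of nonzero components of $x$. The coherence of $A$ (with columns $A_1,\dots,A_n$) is $$\mu=\max_{i\ne j}\frac{|\langle A_i,A_j\rangle|}{\|A_i\|_2\|A_j\|_2}.$$ Defining function: a family of real functions $f_\tau(u)$ (threshold $\tau\ge0$, defined for $|u|\ge\tau$) such that (1) $f_\tau$ is odd; (2) $f_\tau(u)<f_\tau(v)$ whenever $\tau\le u<v$; (3) there are constants $0\le c_2\le c_1\le1$ (the boundedness parameters) with $u-c_1\tau\le f_\tau(u)\le u-c_2\tau$ for all $u\ge\tau$. AIT (adaptively iterative thresholding) algorithm: given $A\in\mathbf{R}^{m\times n}$ with unit $\ell_2$-norm columns, $b\in\mathbf{R}^m$, a sparsity level $k$ (with $1\le k<n$), a step size $s>0$ and an initial point $x^{(0)}$, for $t=0,1,2,\dots$: set $z^{(t+1)}=x^{(t)}-sA^T(Ax^{(t)}-b)$; let $I^{t+1}$ be the index set of the $k$ largest components of $z^{(t+1)}$ in magnitude and let $\tau^{(t+1)}=|z^{(t+1)}_{[k+1]}|$, where $[k+1]$ is the index of the $(k+1)$-th largest component of $z^{(t+1)}$ in magnitude (ties broken arbitrarily, $[k+1]\notin I^{t+1}$); set $x^{(t+1)}_i=f_{\tau^{(t+1)}}(z^{(t+1)}_i)$ for $i\in I^{t+1}$ and $x^{(t+1)}_i=0$ otherwise. *)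

theory Defs imports "HOL-Analysis.Analysis" begin

definition l0_norm :: "real ^ 'n \<Rightarrow> nat" where
  "l0_norm x = card {i. x $ i \<noteq> 0}"

definition l1_norm :: "real ^ 'n \<Rightarrow> real" where
  "l1_norm x = (\<Sum>i\<in>UNIV. \<bar>x $ i\<bar>)"

(* The index pairs range over a nonempty set only if there are at least two columns. *)
definition coherence :: "real ^ 'n ^ 'm \<Rightarrow> real" where
  "coherence A =
     Max {\<bar>column i A \<bullet> column j A\<bar> / (norm (column i A) * norm (column j A)) | i j. i \<noteq> j}"

(* f \<tau> u is only meaningful for \<tau> \<ge> 0 and \<bar>u\<bar> \<ge> \<tau>; its values elsewhere are unconstrained. *)
definition defining_function :: "(real \<Rightarrow> real \<Rightarrow> real) \<Rightarrow> real \<Rightarrow> real \<Rightarrow> bool" where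
  "defining_function f c1 c2 \<longleftrightarrow>
     0 \<le> c2 \<and> c2 \<le> c1 \<and> c1 \<le> 1 \<and>
     (\<forall>\<tau>\<ge>0.
        (\<forall>u. \<tau> \<le> \<bar>u\<bar> \<longrightarrow> f \<tau> (- u) = - f \<tau> u) \<and>
        (\<forall>u v. \<tau> \<le> u \<and> u < v \<longrightarrow> f \<tau> u < f \<tau> v) \<and>
        (\<forall>u\<ge>\<tau>. u - c1 * \<tau> \<le> f \<tau> u \<and> f \<tau> u \<le> u - c2 * \<tau>))"

(* p r is the index of the r-th largest component of z in magnitude (r = 1, ..., n).
   If there are ties, several p qualify. *)
definition magnitude_ranking :: "(nat \<Rightarrow> 'n) \<Rightarrow> real ^ 'n \<Rightarrow> bool" where
  "magnitude_ranking p z \<longleftrightarrow>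
     bij_betw p {1..CARD('n)} UNIV \<and>
     (\<forall>q\<in>{1..CARD('n)}. \<forall>r\<in>{1..CARD('n)}. q \<le> r \<longrightarrow> \<bar>z $ p r\<bar> \<le> \<bar>z $ p q\<bar>)"

(* One thresholding step, as a relation because ties may be broken arbitrarily.
   Requires k < CARD('n), so that p (k + 1) is an actual rank. *)
definition ait_threshold ::
  "(real \<Rightarrow> real \<Rightarrow> real) \<Rightarrow> nat \<Rightarrow> real ^ 'n \<Rightarrow> real ^ 'n \<Rightarrow> bool" where
  "ait_threshold f k z y \<longleftrightarrow>
     (\<exists>p. magnitude_ranking p z \<and>
          y = (\<chi> i. if i \<in> p ` {1..k} then f \<bar>z $ p (k + 1)\<bar> (z $ i) else 0))"

definition ait_sequence ::
  "real ^ 'n ^ 'm \<Rightarrow> real ^ 'm \<Rightarrow> nat \<Rightarrow> real \<Rightarrow> (real \<Rightarrow> real \<Rightarrow> real) \<Rightarrow> real ^ 'n \<Rightarrow>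
   (nat \<Rightarrow> real ^ 'n) \<Rightarrow> bool" where
  "ait_sequence A b k s f x0 x \<longleftrightarrow>
     x 0 = x0 \<and>
     (\<forall>t. ait_threshold f k (x t - s *\<^sub>R (transpose A *v (A *v x t - b))) (x (Suc t)))"

end

theory Submission imports Defs begin

text \<open>
  The argument shows that one step of the algorithm contracts the \<open>\<ell>\<^sub>1\<close> error up to the noise term,
  by passing through the \<open>\<ell>\<^sub>\<infinity>\<close> norm.

  Since the columns are unit vectors, the Gram matrix \<open>A\<^sup>T A\<close> has diagonal entries \<open>1\<close> and off-diagonal
  entries of size at most \<open>\<mu>\<close>.  Hence every entry of \<open>I - s A\<^sup>T A\<close> is bounded by
  \<open>\<gamma> = max \<bar>1 - s\<bar> (s \<mu>)\<close>, and the gradient step turns an \<open>\<ell>\<^sub>1\<close> error \<open>e\<close> into a componentwise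
  error of at most \<open>\<beta> = \<gamma> e + s \<parallel>A\<^sup>T \<epsilon>\<parallel>\<^sub>\<infinity>\<close> (\<open>gradient_step_error\<close>).

  Thresholding then turns this componentwise bound back into the \<open>\<ell>\<^sub>1\<close> bound \<open>(3 - c\<^sub>2) k \<beta>\<close>
  (\<open>thresholding_l1_error\<close>).  Among the \<open>k + 1\<close> largest components one lies outside the \<open>k\<close>-element
  support \<open>S\<close> of the target, so the threshold satisfies \<open>\<tau> \<le> \<beta>\<close>.  Let \<open>I\<close> be the selected index set
  and \<open>d = card (S - I) = card (I - S)\<close>.  The error is at most \<open>\<beta> + \<tau>\<close> on \<open>I \<inter> S\<close> (shrinkage plus
  gradient error), at most \<open>\<beta> - c\<^sub>2 \<tau>\<close> on \<open>I - S\<close> (shrinkage helps there, because the target vanishes), and at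
  most \<open>\<beta> + \<tau>\<close> on \<open>S - I\<close>, where the component of the target was lost.  Pairing each index
  of \<open>S - I\<close> with one of \<open>I - S\<close> gives \<open>(k - d) (\<beta> + \<tau>) + d (2 \<beta> + (1 - c\<^sub>2) \<tau>)\<close>, and
  \<open>\<tau> \<le> \<beta>\<close>, \<open>d \<le> k\<close> bound it by \<open>(3 - c\<^sub>2) k \<beta>\<close>.

  With \<open>L = (3 - c\<^sub>2) k\<close> one step thus maps an error \<open>e\<close> to at most
  \<open>\<gamma> L e + s L \<parallel>A\<^sup>T \<epsilon>\<parallel>\<^sub>\<infinity>\<close>.  The conditions on \<open>s\<close> say exactly that \<open>\<bar>1 - s\<bar> < 1 / L\<close> and
  \<open>s \<mu> < 1 / L\<close>, that is \<open>\<gamma> L < 1\<close>, and iterating the affine recursion gives the estimate.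
\<close>

lemma abs_inner_columns_le_coherence:
  fixes A :: "real ^ 'n ^ 'm"
  assumes unit: "\<forall>i. norm (column i A) = 1" and "i \<noteq> j"
  shows "\<bar>column i A \<bullet> column j A\<bar> \<le> coherence A"
proof -
  let ?g = "\<lambda>i j. \<bar>column i A \<bullet> column j A\<bar> / (norm (column i A) * norm (column j A))"
  have "{?g i j | i j. i \<noteq> j} \<subseteq> (\<lambda>(i, j). ?g i j) ` UNIV"
    by auto
  then have "finite {?g i j | i j. i \<noteq> j}"
    by (rule finite_subset) simp
  moreover have "?g i j \<in> {?g i j | i j. i \<noteq> j}"
    using \<open>i \<noteq> j\<close> by blast
  ultimately have "?g i j \<le> coherence A"
    unfolding coherence_def by (rule Max_ge)
  then show ?thesis
    using unit by simp
qed

lemma transpose_mult_component: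
  fixes A :: "real ^ 'n ^ 'm"
  shows "(transpose A *v v) $ i = column i A \<bullet> v"
  by (simp add: matrix_vector_mult_def transpose_def column_def inner_vec_def)

lemma gram_mult_component:
  fixes A :: "real ^ 'n ^ 'm"
  shows "(transpose A *v (A *v e)) $ i = (\<Sum>j\<in>UNIV. (column i A \<bullet> column j A) * e $ j)"
  unfolding transpose_mult_component matrix_mult_sum [of A]
  by (simp add: inner_sum_right scalar_mult_eq_scaleR mult.commute)

text \<open>
  The iteration error is multiplied by \<open>I - s A\<^sup>T A\<close>, all of whose entries are at most \<open>\<gamma>\<close> in
  magnitude, so each component of the result is at most \<open>\<gamma>\<close> times the \<open>\<ell>\<^sub>1\<close> norm of the error.
\<close>

lemma gradient_step_error:
  fixes A :: "real ^ 'n ^ 'm"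
  assumes unit: "\<forall>i. norm (column i A) = 1" and "0 \<le> s"
    and diag: "\<bar>1 - s\<bar> \<le> \<gamma>" and offdiag: "s * coherence A \<le> \<gamma>"
  shows "\<bar>(x - s *\<^sub>R (transpose A *v (A *v x - (A *v y + \<epsilon>)))) $ i - y $ i\<bar>
    \<le> \<gamma> * l1_norm (x - y) + s * infnorm (transpose A *v \<epsilon>)"
proof -
  define e where "e = x - y"
  define c where "c j = (if j = i then 1 else 0) - s * (column i A \<bullet> column j A)" for j
  have entry: "\<bar>c j\<bar> \<le> \<gamma>" for j
  proof (cases "j = i")
    case True
    then show ?thesis
      using unit diag by (simp add: c_def dot_square_norm)
  next
    case False
    then have "s * \<bar>column i A \<bullet> column j A\<bar> \<le> s * coherence A"
      using unit \<open>0 \<le> s\<close> by (intro mult_left_mono abs_inner_columns_le_coherence) auto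
    then show ?thesis
      using False offdiag \<open>0 \<le> s\<close> by (simp add: c_def abs_mult)
  qed
  have residual: "A *v x - (A *v y + \<epsilon>) = A *v e - \<epsilon>"
    by (simp add: e_def matrix_vector_mult_diff_distrib)
  have "(\<Sum>j\<in>UNIV. c j * e $ j) = e $ i - s * (transpose A *v (A *v e)) $ i"
    unfolding c_def gram_mult_component left_diff_distrib sum_subtractf
    by (simp add: sum_distrib_left mult.assoc if_distrib [of "\<lambda>a. a * _"] cong: if_cong)
  then have "(x - s *\<^sub>R (transpose A *v (A *v x - (A *v y + \<epsilon>)))) $ i - y $ i
      = (\<Sum>j\<in>UNIV. c j * e $ j) + s * (transpose A *v \<epsilon>) $ i"
    unfolding residual by (simp add: matrix_vector_mult_diff_distrib e_def algebra_simps)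
  also have "\<bar>\<dots>\<bar> \<le> (\<Sum>j\<in>UNIV. \<bar>c j\<bar> * \<bar>e $ j\<bar>) + s * \<bar>(transpose A *v \<epsilon>) $ i\<bar>"
    using \<open>0 \<le> s\<close> sum_abs [of "\<lambda>j. c j * e $ j" UNIV]
      abs_triangle_ineq [of "\<Sum>j\<in>UNIV. c j * e $ j" "s * (transpose A *v \<epsilon>) $ i"]
    by (simp add: abs_mult)
  also have "\<dots> \<le> (\<Sum>j\<in>UNIV. \<gamma> * \<bar>e $ j\<bar>) + s * infnorm (transpose A *v \<epsilon>)"
    using entry \<open>0 \<le> s\<close>
    by (intro add_mono sum_mono mult_right_mono mult_left_mono component_le_infnorm_cart) auto
  finally show ?thesis
    by (simp add: l1_norm_def e_def sum_distrib_left)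
qed

text \<open>
  Oddness carries the bounds for \<open>u \<ge> \<tau>\<close> over to \<open>u \<le> - \<tau>\<close>.
\<close>

lemma defining_function_bounds:
  assumes "defining_function f c1 c2" and "0 \<le> \<tau>" and "\<tau> \<le> \<bar>u\<bar>"
  shows "\<bar>f \<tau> u\<bar> \<le> \<bar>u\<bar> - c2 * \<tau>" and "\<bar>f \<tau> u - u\<bar> \<le> \<tau>"
proof -
  have c: "0 \<le> c2" "c1 \<le> 1"
    using assms(1) by (auto simp: defining_function_def)
  have bounds: "\<bar>u\<bar> - c1 * \<tau> \<le> f \<tau> \<bar>u\<bar>" "f \<tau> \<bar>u\<bar> \<le> \<bar>u\<bar> - c2 * \<tau>"
    and odd: "f \<tau> (- u) = - f \<tau> u"
    using assms by (auto simp: defining_function_def)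
  have "c1 * \<tau> \<le> \<tau>" "0 \<le> c2 * \<tau>"
    using c \<open>0 \<le> \<tau>\<close> mult_right_mono [of c1 1 \<tau>] by auto
  then show "\<bar>f \<tau> u\<bar> \<le> \<bar>u\<bar> - c2 * \<tau>" "\<bar>f \<tau> u - u\<bar> \<le> \<tau>"
    using bounds odd \<open>\<tau> \<le> \<bar>u\<bar>\<close> by (cases "0 \<le> u"; simp)+
qed

text \<open>
  By the pigeonhole principle one of the \<open>k + 1\<close> largest components of \<open>z\<close> has its index outside the
  support of \<open>y\<close>, where \<open>z\<close> consists of error only.
\<close>

lemma threshold_le_error:
  fixes y z :: "real ^ 'n"
  assumes rank: "magnitude_ranking p z" and "k < CARD('n)" and "l0_norm y \<le> k"
    and err: "\<And>i. \<bar>z $ i - y $ i\<bar> \<le> \<beta>"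
  shows "\<bar>z $ p (k + 1)\<bar> \<le> \<beta>"
proof -
  have "inj_on p {1..k + 1}"
    using rank \<open>k < CARD('n)\<close>
    by (auto simp: magnitude_ranking_def bij_betw_def elim: inj_on_subset)
  then have "card (p ` {1..k + 1}) = k + 1"
    by (simp add: card_image)
  then have "\<not> p ` {1..k + 1} \<subseteq> {i. y $ i \<noteq> 0}"
    using \<open>l0_norm y \<le> k\<close> card_mono [of "{i. y $ i \<noteq> 0}" "p ` {1..k + 1}"]
    by (auto simp: l0_norm_def)
  then obtain r where r: "r \<in> {1..k + 1}" "y $ p r = 0"
    by blast
  then have "\<bar>z $ p (k + 1)\<bar> \<le> \<bar>z $ p r\<bar>"
    using rank \<open>k < CARD('n)\<close> by (auto simp: magnitude_ranking_def)
  also have "\<dots> \<le> \<beta>"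
    using err [of "p r"] r by simp
  finally show ?thesis .
qed

text \<open>
  The error is at most \<open>\<beta> + \<tau> \<le> 2 \<beta>\<close> at each of the at most \<open>2 k\<close> indices involved, which alone
  would give the constant \<open>4\<close>.  The constant \<open>3 - c\<^sub>2\<close> comes from the wrongly selected indices
  \<open>I - S\<close>: the target vanishes there, so shrinking by at least \<open>c\<^sub>2 \<tau>\<close> reduces the error instead of
  adding to it, and there are as many of these indices as there are lost ones in \<open>S - I\<close>.
\<close>

lemma thresholding_l1_error:
  fixes w y z :: "real ^ 'n"
  assumes f: "defining_function f c1 c2" and thr: "ait_threshold f k z w"
    and "k < CARD('n)" and supp: "l0_norm y = k"
    and err: "\<And>i. \<bar>z $ i - y $ i\<bar> \<le> \<beta>"
  shows "l1_norm (w - y) \<le> (3 - c2) * real k * \<beta>"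
proof -
  obtain p where rank: "magnitude_ranking p z"
    and w: "w = (\<chi> i. if i \<in> p ` {1..k} then f \<bar>z $ p (k + 1)\<bar> (z $ i) else 0)"
    using thr by (auto simp: ait_threshold_def)
  define \<tau> where "\<tau> = \<bar>z $ p (k + 1)\<bar>"
  define I where "I = p ` {1..k}"
  define S where "S = {i. y $ i \<noteq> 0}"
  define d where "d = card (S - I)"
  have w_in: "w $ i = f \<tau> (z $ i)" if "i \<in> I" for i
    using that by (simp add: w \<tau>_def I_def)
  have w_out: "w $ i = 0" if "i \<notin> I" for i
    using that by (simp add: w I_def)
  have "0 \<le> \<tau>"
    by (simp add: \<tau>_def)
  have "\<tau> \<le> \<beta>"
    unfolding \<tau>_def using rank \<open>k < CARD('n)\<close> supp err by (intro threshold_le_error) auto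
  have p: "inj_on p {1..CARD('n)}" "p ` {1..CARD('n)} = UNIV"
    and mono: "\<And>q r. \<lbrakk>q \<in> {1..CARD('n)}; r \<in> {1..CARD('n)}; q \<le> r\<rbrakk> \<Longrightarrow> \<bar>z $ p r\<bar> \<le> \<bar>z $ p q\<bar>"
    using rank by (auto simp: magnitude_ranking_def bij_betw_def)
  have z_in: "\<tau> \<le> \<bar>z $ i\<bar>" if "i \<in> I" for i
    using that \<open>k < CARD('n)\<close> by (auto simp: I_def \<tau>_def intro!: mono)
  have z_out: "\<bar>z $ i\<bar> \<le> \<tau>" if "i \<notin> I" for i
  proof -
    have "i \<in> p ` {1..CARD('n)}"
      using p(2) by simp
    then obtain r where r: "r \<in> {1..CARD('n)}" "i = p r"
      by blast
    then have "k + 1 \<le> r"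
      using that by (auto simp: I_def not_less_eq_eq [symmetric])
    then show ?thesis
      unfolding \<tau>_def \<open>i = p r\<close> using r \<open>k < CARD('n)\<close> by (intro mono) auto
  qed
  have "card I = k"
    unfolding I_def using p(1) \<open>k < CARD('n)\<close>
    by (subst card_image) (auto elim: inj_on_subset)
  moreover have "card S = k"
    using supp by (simp add: l0_norm_def S_def)
  ultimately have "card (I - S) = d"
    using card_Diff_subset_Int [of I S] card_Diff_subset_Int [of S I]
    by (simp add: d_def Int_commute)
  have "card (S \<inter> I) + d = k"
    using card_Int_Diff [of S I] \<open>card S = k\<close> by (simp add: d_def)
  then have card_both: "real (card (S \<inter> I)) = real k - real d" and "d \<le> k"
    by linarith+
  have both: "\<bar>w $ i - y $ i\<bar> \<le> \<beta> + \<tau>" if "i \<in> S \<inter> I" for i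
    using that err [of i] defining_function_bounds(2) [OF f \<open>0 \<le> \<tau>\<close> z_in, of i] by (simp add: w_in)
  have lost: "\<bar>w $ i - y $ i\<bar> \<le> \<beta> + \<tau>" if "i \<in> S - I" for i
    using that err [of i] z_out [of i] by (simp add: w_out)
  have wrong: "\<bar>w $ i - y $ i\<bar> \<le> \<beta> - c2 * \<tau>" if "i \<in> I - S" for i
    using that err [of i] defining_function_bounds(1) [OF f \<open>0 \<le> \<tau>\<close> z_in, of i]
    by (simp add: w_in S_def)
  note sum_le = sum_bounded_above [where f = "\<lambda>i. \<bar>w $ i - y $ i\<bar>"]
  have "l1_norm (w - y) = (\<Sum>i\<in>(S \<inter> I) \<union> (S - I) \<union> (I - S). \<bar>w $ i - y $ i\<bar>)"
    unfolding l1_norm_def by (intro sum.mono_neutral_cong_right) (auto simp: w_out S_def)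
  also have "\<dots> = (\<Sum>i\<in>S \<inter> I. \<bar>w $ i - y $ i\<bar>) + (\<Sum>i\<in>S - I. \<bar>w $ i - y $ i\<bar>)
      + (\<Sum>i\<in>I - S. \<bar>w $ i - y $ i\<bar>)"
    by (subst sum.union_disjoint; auto)+
  also have "\<dots> \<le> (real k - real d) * (\<beta> + \<tau>) + real d * (\<beta> + \<tau>) + real d * (\<beta> - c2 * \<tau>)"
    using sum_le [of "S \<inter> I", OF both] sum_le [of "S - I", OF lost] sum_le [of "I - S", OF wrong]
    unfolding card_both \<open>card (I - S) = d\<close> d_def [symmetric] by linarith
  also have "\<dots> = real k * \<beta> + real d * \<beta> + ((real k - real d) + real d * (1 - c2)) * \<tau>"
    by (simp add: algebra_simps)
  also have "\<dots> \<le> real k * \<beta> + real d * \<beta> + ((real k - real d) + real d * (1 - c2)) * \<beta>"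
    using f \<open>\<tau> \<le> \<beta>\<close> \<open>d \<le> k\<close> by (intro add_left_mono mult_right_mono mult_left_mono)
      (auto simp: defining_function_def)
  also have "\<dots> = (2 * real k + real d * (1 - c2)) * \<beta>"
    by (simp add: algebra_simps)
  also have "\<dots> \<le> (2 * real k + real k * (1 - c2)) * \<beta>"
    using f \<open>0 \<le> \<tau>\<close> \<open>\<tau> \<le> \<beta>\<close> \<open>d \<le> k\<close> by (intro mult_right_mono add_left_mono)
      (auto simp: defining_function_def)
  finally show ?thesis
    by (simp add: algebra_simps)
qed

text \<open>
  The constant \<open>h / (1 - \<rho>)\<close> is the fixed point of \<open>a \<mapsto> \<rho> a + h\<close>.
\<close>

lemma affine_recursion_bound:
  fixes a :: "nat \<Rightarrow> real"
  assumes step: "\<And>t. a (Suc t) \<le> \<rho> * a t + h" and "0 \<le> \<rho>" and "\<rho> < 1" and "0 \<le> h"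
  shows "a t \<le> \<rho> ^ t * a 0 + h / (1 - \<rho>)"
proof (induction t)
  case 0
  then show ?case
    using assms by simp
next
  case (Suc t)
  have "a (Suc t) \<le> \<rho> * (\<rho> ^ t * a 0 + h / (1 - \<rho>)) + h"
    using step [of t] mult_left_mono [OF Suc \<open>0 \<le> \<rho>\<close>] by linarith
  also have "\<dots> = \<rho> ^ Suc t * a 0 + h / (1 - \<rho>)"
    using \<open>\<rho> < 1\<close> by (simp add: field_simps)
  finally show ?case .
qed

theorem theorem3:
  fixes A :: "real ^ 'n ^ 'm"
    and xstar x0 :: "real ^ 'n" and \<epsilon> b :: "real ^ 'm"
    and x :: "nat \<Rightarrow> real ^ 'n"
    and f :: "real \<Rightarrow> real \<Rightarrow> real"
    and k kstar :: nat
    and s c1 c2 L \<mu> \<gamma> \<rho> :: real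
  assumes "\<forall>i. norm (column i A) = 1"
    and "l0_norm xstar = kstar" and "1 \<le> kstar"
    and "b = A *v xstar + \<epsilon>"
    and "defining_function f c1 c2"
    and "1 \<le> k" and "k < CARD('n)" and "0 < s"
    and "ait_sequence A b k s f x0 x"
    and "L = (3 - c2) * real kstar"
    and "\<mu> = coherence A"
    and "0 < \<mu>" and "\<mu> < 1 / ((3 - c2) * real kstar)"
    and "k = kstar"
    and "1 - 1 / L < s" and "s < min (1 / (L * \<mu>)) (1 + 1 / L)"
    and "\<gamma> = max \<bar>1 - s\<bar> (s * \<mu>)"
    and "\<rho> = \<gamma> * L"
  shows "\<rho> < 1 \<and>
    (\<forall>t. l1_norm (x t - xstar)
          \<le> \<rho> ^ t * l1_norm (xstar - x0) + s * L / (1 - \<rho>) * infnorm (transpose A *v \<epsilon>)) \<and>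
    (\<epsilon> = 0 \<longrightarrow> (\<forall>t. l1_norm (x t - xstar) \<le> \<rho> ^ t * l1_norm (xstar - x0)))"
proof -
  have c: "c2 \<le> 1"
    using assms(5) by (auto simp: defining_function_def)
  then have "0 < L"
    using assms(3,10) by simp
  have "\<bar>1 - s\<bar> < 1 / L"
    using assms(15,16) by auto
  moreover have "s * \<mu> < 1 / L"
    using assms(12,16) \<open>0 < L\<close> by (simp add: field_simps)
  ultimately have "\<gamma> < 1 / L"
    using assms(17) by simp
  then have "\<rho> < 1"
    using \<open>0 < L\<close> assms(18) by (simp add: field_simps)
  have "0 \<le> \<rho>"
    using \<open>0 < L\<close> assms(17,18) by simp
  define \<eta> where "\<eta> = infnorm (transpose A *v \<epsilon>)"
  have step: "l1_norm (x (Suc t) - xstar) \<le> \<rho> * l1_norm (x t - xstar) + s * L * \<eta>" for t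
  proof -
    define z where "z = x t - s *\<^sub>R (transpose A *v (A *v x t - b))"
    have "\<bar>z $ i - xstar $ i\<bar> \<le> \<gamma> * l1_norm (x t - xstar) + s * \<eta>" for i
      unfolding z_def \<eta>_def assms(4)
      using assms(1,8,11,17) by (intro gradient_step_error) auto
    moreover have "ait_threshold f k z (x (Suc t))"
      using assms(9) by (simp add: ait_sequence_def z_def)
    ultimately have "l1_norm (x (Suc t) - xstar)
        \<le> (3 - c2) * real k * (\<gamma> * l1_norm (x t - xstar) + s * \<eta>)"
      using assms(2,5,7,14) by (intro thresholding_l1_error) auto
    then show ?thesis
      unfolding assms(14) assms(10) [symmetric] assms(18) by (simp add: algebra_simps)
  qed
  have "l1_norm (x 0 - xstar) = l1_norm (xstar - x0)"
    using assms(9) by (simp add: ait_sequence_def l1_norm_def abs_minus_commute)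
  moreover have "0 \<le> s * L * \<eta>"
    using assms(8) \<open>0 < L\<close> by (simp add: \<eta>_def infnorm_pos_le)
  ultimately have bound:
    "l1_norm (x t - xstar) \<le> \<rho> ^ t * l1_norm (xstar - x0) + s * L / (1 - \<rho>) * \<eta>" for t
    using affine_recursion_bound [of "\<lambda>t. l1_norm (x t - xstar)", OF step \<open>0 \<le> \<rho>\<close> \<open>\<rho> < 1\<close>] by simp
  moreover have "\<eta> = 0" if "\<epsilon> = 0"
    using that by (simp add: \<eta>_def infnorm_0)
  ultimately show ?thesis
    using \<open>\<rho> < 1\<close> by (fastforce simp: \<eta>_def)
qed

end
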